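(* Let $d$ and $k$ be positive integers with $k\leq 2d-1$. Then there is a subset of the generator set $G_1(d,2)$ whose Minkowski sum $\sum_{v\in T}[0,1]v$ (for that subset $T\subseteq G_1(d,2)$) is, up to translation, a lattice $(d,k)$-polytope with edge-diameter $\lfloor (k+1)d/2\rfloor$. Consequently, for $k\leq 2d-1$, $\delta(d,k)\geq \lfloor (k+1)d/2\rfloor$. For instance, $H_1^+(d,2)$ is a lattice $(d,d)$-polytope with edge-diameter $\binom{d+1}{2}$, and $H_1(d,2)$ is, up to translation, a lattice $(d,2d-1)$-polytope with edge-diameter $d^2$.
   Context: A lattice $(d,k)$-polytope is a full-dimensional polytope in $\mathbb{R}^d$ that is the convex hull of points all drawn from $\{0,1,\dots,k\}^d$. The (edge-)diameter of a polytope is the diameter of its graph formed by vertices and edges. $\delta(d,k)$ denotes the maximum edge-diameter over all lattice $(d,k)$-polytopes. For $v\in\mathbb{Z}^d$, $\gcd(v)$ is the largest integer dividing all entries of $v$, and $v\succ 0$ means the first nonzero coordinate of $v$ is positive. Let $G_1(d,2)=\{v\in\mathbb{Z}^d : \|v\|_1\leq 2,\ \gcd(v)=1,\ v\succ 0\}$ (i.e. the unit vectors $e_i$, and $e_i+e_j$, $e_i-e_j$ for $i<j$), and $H_1(d,2)=\sum_{v\in G_1(d,2)}[0,1]v$ (Minkowski sum of the segments $[0,v]$). Let $H_1^+(d,2)=\sum[0,1]\{v\in\mathbb{Z}_{+}^d : \|v\|_1\leq 2,\ \gcd(v)=1\}$, where $\mathbb{Z}_+=\{0,1,2,\dots\}$.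 *)

theory Defs
  imports "HOL-Analysis.Analysis"
begin

text \<open>Points of R^d are vectors real^'n with d = CARD('n). The index type carries a
  linear order (needed for the lexicographic positivity condition v \<succ> 0).\<close>

definition lattice_polytope :: "nat \<Rightarrow> (real^'n) set \<Rightarrow> bool" where
  "lattice_polytope k P \<longleftrightarrow>
     (\<exists>S. finite S \<and> S \<subseteq> {x. \<forall>i. x $ i \<in> real ` {0..k}} \<and> P = convex hull S)
     \<and> aff_dim P = int CARD('n)"

definition poly_vertices :: "(real^'n) set \<Rightarrow> (real^'n) set" where
  "poly_vertices P = {v. v extreme_point_of P}"

definition poly_adj :: "(real^'n) set \<Rightarrow> real^'n \<Rightarrow> real^'n \<Rightarrow> bool" where
  "poly_adj P v w \<longleftrightarrow> v \<in> poly_vertices P \<and> w \<in> poly_vertices P \<and> v \<noteq> w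
     \<and> closed_segment v w face_of P"

definition poly_walk :: "(real^'n) set \<Rightarrow> (real^'n) list \<Rightarrow> bool" where
  "poly_walk P xs \<longleftrightarrow> xs \<noteq> [] \<and> set xs \<subseteq> poly_vertices P
     \<and> (\<forall>i. Suc i < length xs \<longrightarrow> poly_adj P (xs ! i) (xs ! Suc i))"

definition graph_dist :: "(real^'n) set \<Rightarrow> real^'n \<Rightarrow> real^'n \<Rightarrow> nat" where
  "graph_dist P v w = (LEAST n. \<exists>xs. poly_walk P xs \<and> hd xs = v \<and> last xs = w
                                      \<and> length xs = Suc n)"

definition edge_diameter :: "(real^'n) set \<Rightarrow> nat" where
  "edge_diameter P = Sup {graph_dist P v w | v w. v \<in> poly_vertices P \<and> w \<in> poly_vertices P}"

definition delta :: "('n::finite) itself \<Rightarrow> nat \<Rightarrow> nat" where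
  "delta _ k = Sup {edge_diameter P | P :: (real^'n) set. lattice_polytope k P}"

definition vec_of_int :: "int^'n \<Rightarrow> real^'n" where
  "vec_of_int v = (\<chi> i. real_of_int (v $ i))"

definition l1norm_int :: "int^'n \<Rightarrow> int" where
  "l1norm_int v = (\<Sum>i\<in>UNIV. \<bar>v $ i\<bar>)"

definition vgcd :: "int^'n \<Rightarrow> int" where
  "vgcd v = Gcd (range (\<lambda>i. v $ i))"

definition lex_pos :: "int^('n::{finite,linorder}) \<Rightarrow> bool" where
  "lex_pos v \<longleftrightarrow> (\<exists>i. v $ i > 0 \<and> (\<forall>j. j < i \<longrightarrow> v $ j = 0))"

definition G1 :: "(real^('n::{finite,linorder})) set" where
  "G1 = vec_of_int ` {v. l1norm_int v \<le> 2 \<and> vgcd v = 1 \<and> lex_pos v}"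

definition G1plus :: "(real^'n) set" where
  "G1plus = vec_of_int ` {v. (\<forall>i. v $ i \<ge> 0) \<and> l1norm_int v \<le> 2 \<and> vgcd v = 1}"

definition zonotope :: "(real^'n) set \<Rightarrow> (real^'n) set" where
  "zonotope T = {(\<Sum>v\<in>T. c v *\<^sub>R v) | c. \<forall>v\<in>T. 0 \<le> c v \<and> c v \<le> 1}"

definition H1 :: "(real^('n::{finite,linorder})) set" where
  "H1 = zonotope G1"

definition H1plus :: "(real^'n) set" where
  "H1plus = zonotope G1plus"

end

theory Submission
  imports Defs
begin

text \<open>The vertices of the zonotope of pairwise noncollinear generators \<open>T\<close> are the sums of the
  generators that are positive under a functional \<open>a\<close> vanishing on no generator. An edge
  changes the set of positive generators by exactly one element, and from every vertex some edge
  leads closer to any other vertex, so graph distance is the size of the symmetric difference;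
  the vertices of \<open>a\<close> and \<open>- a\<close> are at the maximal distance \<open>card T\<close>.
  It remains to choose \<open>\<lfloor>(k + 1) d / 2\<rfloor>\<close> generators, among them all unit vectors, such that each
  coordinate is nonzero in at most \<open>k\<close> of them. This is a degree-constrained multigraph on \<open>d\<close>
  vertices, obtained from a circulant graph and, for even \<open>k\<close>, a matching.\<close>

section \<open>Vertices of a zonotope\<close>

text \<open>The strict inequality leaves out generators orthogonal to \<open>a\<close>; their
  coefficients are the free ones on the face that maximises \<open>a\<close>.\<close>

definition pos_gens :: "(real^'n) set \<Rightarrow> real^'n \<Rightarrow> (real^'n) set" where
  "pos_gens T a = {v \<in> T. a \<bullet> v > 0}"

definition generic_for :: "(real^'n) set \<Rightarrow> real^'n \<Rightarrow> bool" where
  "generic_for T a \<longleftrightarrow> (\<forall>v\<in>T. a \<bullet> v \<noteq> 0)"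

lemma pos_gens_subset: "pos_gens T a \<subseteq> T"
  by (auto simp: pos_gens_def)

text \<open>Finitely many hyperplanes form a null set, and a nonempty open set is not null.\<close>

lemma generic_vector_in_open:
  fixes S :: "'a::euclidean_space set"
  assumes "open S" "S \<noteq> {}" "finite V" "0 \<notin> V"
  obtains g where "g \<in> S" "\<And>v. v \<in> V \<Longrightarrow> g \<bullet> v \<noteq> 0"
proof -
  have "negligible (\<Union>v\<in>V. {x. v \<bullet> x = 0})"
    using assms by (intro negligible_Union) (auto intro!: negligible_hyperplane)
  moreover have "\<not> negligible S"
    using assms open_not_negligible by blast
  ultimately obtain g where "g \<in> S" "g \<notin> (\<Union>v\<in>V. {x. v \<bullet> x = 0})"
    using negligible_subset by blast
  then show thesis using that[of g] by (auto simp: inner_commute)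
qed

section \<open>Zonotopes as convex hulls of subset sums\<close>

lemma zonotopeI:
  assumes "\<And>v. v \<in> T \<Longrightarrow> 0 \<le> c v \<and> c v \<le> 1"
  shows "(\<Sum>v\<in>T. c v *\<^sub>R v) \<in> zonotope T"
  using assms unfolding zonotope_def by blast

lemma zonotopeE:
  assumes "x \<in> zonotope T"
  obtains c where "x = (\<Sum>v\<in>T. c v *\<^sub>R v)" "\<And>v. v \<in> T \<Longrightarrow> 0 \<le> c v \<and> c v \<le> 1"
  using assms unfolding zonotope_def by blast

lemma sum_subset_eq_indicator:
  fixes T :: "'a::real_vector set"
  assumes "finite T" "B \<subseteq> T"
  shows "\<Sum>B = (\<Sum>v\<in>T. (if v \<in> B then 1 else 0::real) *\<^sub>R v)"
proof -
  have "(\<Sum>v\<in>T. (if v \<in> B then 1 else 0::real) *\<^sub>R v) = (\<Sum>v\<in>T. if v \<in> B then v else 0)"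
    by (intro sum.cong) auto
  also have "\<dots> = \<Sum>(T \<inter> B)"
    using assms by (simp add: sum.inter_restrict)
  finally show ?thesis using assms by (simp add: Int_absorb1)
qed

lemma sum_subset_in_zonotope:
  assumes "finite T" "B \<subseteq> T"
  shows "\<Sum>B \<in> zonotope T"
  unfolding sum_subset_eq_indicator[OF assms] by (rule zonotopeI) auto

lemma convex_zonotope: "convex (zonotope T)"
proof (rule convexI)
  fix x y and u v :: real
  assume xy: "x \<in> zonotope T" "y \<in> zonotope T" and uv: "0 \<le> u" "0 \<le> v" "u + v = 1"
  obtain c where c: "x = (\<Sum>v\<in>T. c v *\<^sub>R v)" "\<And>v. v \<in> T \<Longrightarrow> 0 \<le> c v \<and> c v \<le> 1"
    using xy(1) by (rule zonotopeE) blast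
  obtain e where e: "y = (\<Sum>v\<in>T. e v *\<^sub>R v)" "\<And>v. v \<in> T \<Longrightarrow> 0 \<le> e v \<and> e v \<le> 1"
    using xy(2) by (rule zonotopeE) blast
  have "u *\<^sub>R x + v *\<^sub>R y = (\<Sum>w\<in>T. (u * c w + v * e w) *\<^sub>R w)"
    unfolding c(1) e(1) by (simp add: scaleR_sum_right sum.distrib scaleR_add_left)
  also have "\<dots> \<in> zonotope T"
  proof (rule zonotopeI)
    fix w assume "w \<in> T"
    then show "0 \<le> u * c w + v * e w \<and> u * c w + v * e w \<le> 1"
      using uv c(2) e(2) by (auto intro!: convex_bound_le)
  qed
  finally show "u *\<^sub>R x + v *\<^sub>R y \<in> zonotope T" .
qed

text \<open>Induction on \<open>T\<close>: a new generator \<open>v\<close> sweeps each point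
  \<open>y\<close> along the segment from \<open>y\<close> to \<open>v + y\<close>, and translating
  a subset sum by \<open>v\<close> gives a subset sum again.\<close>

lemma zonotope_eq_convex_hull:
  assumes "finite T"
  shows "zonotope T = convex hull (Sum ` Pow T)"
proof
  show "convex hull (Sum ` Pow T) \<subseteq> zonotope T"
    using assms by (intro hull_minimal convex_zonotope) (auto intro: sum_subset_in_zonotope)
  show "zonotope T \<subseteq> convex hull (Sum ` Pow T)"
    using assms
  proof (induction T)
    case empty
    then show ?case by (auto simp: zonotope_def)
  next
    case (insert v T)
    let ?H = "convex hull (Sum ` Pow (insert v T))"
    show ?case
    proof
      fix x assume "x \<in> zonotope (insert v T)"
      then obtain c where c: "x = (\<Sum>w\<in>insert v T. c w *\<^sub>R w)"
        "\<And>w. w \<in> insert v T \<Longrightarrow> 0 \<le> c w \<and> c w \<le> 1"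
        by (rule zonotopeE) blast
      define y where "y = (\<Sum>w\<in>T. c w *\<^sub>R w)"
      have y: "y \<in> convex hull (Sum ` Pow T)"
        using insert.IH c(2) unfolding y_def by (auto intro!: zonotopeI)
      have "Sum ` Pow T \<subseteq> Sum ` Pow (insert v T)" by auto
      then have 1: "y \<in> ?H" using y hull_mono by blast
      have "(+) v ` Sum ` Pow T \<subseteq> Sum ` Pow (insert v T)"
      proof clarify
        fix B assume B: "B \<subseteq> T"
        then have "v + \<Sum>B = \<Sum>(insert v B)"
          using insert.hyps by (subst sum.insert) (auto dest: finite_subset)
        then show "v + \<Sum>B \<in> Sum ` Pow (insert v T)" using B by blast
      qed
      moreover have "v + y \<in> convex hull ((+) v ` Sum ` Pow T)"
        using y by (simp add: convex_hull_translation)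
      ultimately have 2: "v + y \<in> ?H" using hull_mono by blast
      have "x = (1 - c v) *\<^sub>R y + c v *\<^sub>R (v + y)"
        using insert.hyps unfolding c(1) y_def by (simp add: algebra_simps)
      also have "\<dots> \<in> ?H"
        using c(2)[of v] 1 2 by (intro convexD[OF convex_convex_hull]) auto
      finally show "x \<in> ?H" .
    qed
  qed
qed

lemma polytope_zonotope: "finite T \<Longrightarrow> polytope (zonotope T)"
  using zonotope_eq_convex_hull polytope_convex_hull by (metis finite_Pow_iff finite_imageI)

section \<open>Maximisers of linear functionals\<close>

text \<open>The gap between the two sides is a sum of terms
  \<open>(?e v - c v) * (h \<bullet> v)\<close>, all nonnegative. Equality makes each term vanish,
  which leaves \<open>c v\<close> free exactly where \<open>h \<bullet> v = 0\<close>.\<close>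

lemma zonotope_support:
  assumes "finite T" "\<And>v. v \<in> T \<Longrightarrow> 0 \<le> c v \<and> c v \<le> 1"
  shows "h \<bullet> (\<Sum>v\<in>T. c v *\<^sub>R v) \<le> h \<bullet> \<Sum>(pos_gens T h)"
    and "h \<bullet> (\<Sum>v\<in>T. c v *\<^sub>R v) = h \<bullet> \<Sum>(pos_gens T h) \<longleftrightarrow>
      (\<forall>v\<in>T. (h \<bullet> v > 0 \<longrightarrow> c v = 1) \<and> (h \<bullet> v < 0 \<longrightarrow> c v = 0))"
proof -
  let ?e = "\<lambda>v. if v \<in> pos_gens T h then 1 else 0 :: real"
  have diff: "h \<bullet> \<Sum>(pos_gens T h) - h \<bullet> (\<Sum>v\<in>T. c v *\<^sub>R v) = (\<Sum>v\<in>T. (?e v - c v) * (h \<bullet> v))"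
    unfolding sum_subset_eq_indicator[OF assms(1) pos_gens_subset]
    by (simp add: inner_sum_right sum_subtractf[symmetric] left_diff_distrib)
  have nonneg: "(?e v - c v) * (h \<bullet> v) \<ge> 0" if "v \<in> T" for v
    using assms(2)[OF that] that
    by (auto simp: pos_gens_def mult_le_0_iff)
  show "h \<bullet> (\<Sum>v\<in>T. c v *\<^sub>R v) \<le> h \<bullet> \<Sum>(pos_gens T h)"
    using diff sum_nonneg[of T "\<lambda>v. (?e v - c v) * (h \<bullet> v)"] nonneg by simp
  have "h \<bullet> (\<Sum>v\<in>T. c v *\<^sub>R v) = h \<bullet> \<Sum>(pos_gens T h) \<longleftrightarrow> (\<forall>v\<in>T. (?e v - c v) * (h \<bullet> v) = 0)"
    using diff sum_nonneg_eq_0_iff[OF assms(1), of "\<lambda>v. (?e v - c v) * (h \<bullet> v)"] nonneg by auto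
  also have "\<dots> \<longleftrightarrow> (\<forall>v\<in>T. (h \<bullet> v > 0 \<longrightarrow> c v = 1) \<and> (h \<bullet> v < 0 \<longrightarrow> c v = 0))"
    by (intro ball_cong) (auto simp: pos_gens_def)
  finally show "h \<bullet> (\<Sum>v\<in>T. c v *\<^sub>R v) = h \<bullet> \<Sum>(pos_gens T h) \<longleftrightarrow>
      (\<forall>v\<in>T. (h \<bullet> v > 0 \<longrightarrow> c v = 1) \<and> (h \<bullet> v < 0 \<longrightarrow> c v = 0))" .
qed

lemma zonotope_supporting_face:
  assumes "finite T"
  shows "zonotope T \<inter> {x. h \<bullet> x = h \<bullet> \<Sum>(pos_gens T h)} face_of zonotope T"
proof (rule face_of_Int_supporting_hyperplane_le[OF convex_zonotope])
  fix x assume "x \<in> zonotope T"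
  then show "h \<bullet> x \<le> h \<bullet> \<Sum>(pos_gens T h)"
    by (rule zonotopeE) (use zonotope_support(1)[OF assms] in blast)
qed

text \<open>The indicator of \<open>B\<close> attains the maximum of \<open>a\<close>, and for
  generic \<open>a\<close> the equality case fixes it on all of \<open>T\<close>. Vertices thus
  determine their subsets, so distances can be counted on subsets.\<close>

lemma generic_unique_subset:
  assumes "finite T" "generic_for T a" "B \<subseteq> T" "\<Sum>B = \<Sum>(pos_gens T a)"
  shows "B = pos_gens T a"
proof -
  have "\<forall>v\<in>T. (a \<bullet> v > 0 \<longrightarrow> (if v \<in> B then 1 else 0::real) = 1) \<and>
      (a \<bullet> v < 0 \<longrightarrow> (if v \<in> B then 1 else 0::real) = 0)"
    using assms(4) sum_subset_eq_indicator[OF assms(1,3)]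
    by (subst zonotope_support(2)[OF assms(1), symmetric]) auto
  then show ?thesis
    using assms(2,3) unfolding pos_gens_def generic_for_def
    by (force split: if_splits dest: linorder_neqE_linordered_idom)
qed

text \<open>With no \<open>a \<bullet> v\<close> zero, the equality case fixes every coefficient, so
  the face maximising \<open>a\<close> is a single point.\<close>

lemma generic_vertex:
  assumes "finite T" "generic_for T a"
  shows "\<Sum>(pos_gens T a) \<in> poly_vertices (zonotope T)"
proof -
  let ?p = "\<Sum>(pos_gens T a)"
  have "zonotope T \<inter> {x. a \<bullet> x = a \<bullet> ?p} = {?p}"
  proof (intro equalityI subsetI)
    fix x assume "x \<in> zonotope T \<inter> {x. a \<bullet> x = a \<bullet> ?p}"
    then have x: "x \<in> zonotope T" "a \<bullet> x = a \<bullet> ?p" by auto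
    from x(1) obtain c where c: "x = (\<Sum>v\<in>T. c v *\<^sub>R v)" "\<And>v. v \<in> T \<Longrightarrow> 0 \<le> c v \<and> c v \<le> 1"
      by (rule zonotopeE) blast
    have "\<forall>v\<in>T. (a \<bullet> v > 0 \<longrightarrow> c v = 1) \<and> (a \<bullet> v < 0 \<longrightarrow> c v = 0)"
      using zonotope_support(2)[OF assms(1) c(2), of "\<lambda>v. v" a] x(2) c(1) by simp
    then have "c v = (if v \<in> pos_gens T a then 1 else 0)" if "v \<in> T" for v
      using that assms(2) by (auto simp: pos_gens_def generic_for_def not_less_iff_gr_or_eq)
    then show "x \<in> {?p}"
      unfolding sum_subset_eq_indicator[OF assms(1) pos_gens_subset] c(1) by simp
  qed (use sum_subset_in_zonotope[OF assms(1) pos_gens_subset] in auto)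
  then show ?thesis
    using zonotope_supporting_face[OF assms(1), of a] by (simp add: poly_vertices_def face_of_singleton)
qed

text \<open>A vertex of a polytope is exposed, hence the unique maximiser of some \<open>a\<close>.
  Changing one coefficient within [0,1] must then strictly lower \<open>a\<close>, which makes
  \<open>a\<close> generic and forces each coefficient to be 0 or 1.\<close>

lemma vertex_generic:
  assumes "finite T" "0 \<notin> T" "p \<in> poly_vertices (zonotope T)"
  obtains a where "generic_for T a" "p = \<Sum>(pos_gens T a)"
proof -
  have "{p} exposed_face_of zonotope T"
    using assms(3) exposed_face_of_polyhedron[OF polytope_imp_polyhedron[OF polytope_zonotope[OF assms(1)]]]
    by (simp add: poly_vertices_def face_of_singleton)
  then obtain a b where ab: "zonotope T \<subseteq> {x. a \<bullet> x \<le> b}" "{p} = zonotope T \<inter> {x. a \<bullet> x = b}"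
    unfolding exposed_face_of_def by blast
  then have pZ: "p \<in> zonotope T" and pb: "a \<bullet> p = b" by auto
  from pZ obtain c where c: "p = (\<Sum>v\<in>T. c v *\<^sub>R v)" "\<And>v. v \<in> T \<Longrightarrow> 0 \<le> c v \<and> c v \<le> 1"
    by (rule zonotopeE) blast
  have less: "a \<bullet> x < b" if "x \<in> zonotope T" "x \<noteq> p" for x
    using ab that by fastforce
  have upd: "p + r *\<^sub>R v \<in> zonotope T" if "v \<in> T" "0 \<le> c v + r" "c v + r \<le> 1" for v r
  proof -
    have "p + r *\<^sub>R v = (\<Sum>w\<in>T. (c(v := c v + r)) w *\<^sub>R w)"
      using assms(1) that(1) unfolding c(1) by (simp add: sum.remove[of T v] scaleR_add_left)
    also have "\<dots> \<in> zonotope T" using that c(2) by (intro zonotopeI) auto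
    finally show ?thesis .
  qed
  have step: "r * (a \<bullet> v) < 0" if "v \<in> T" "0 \<le> c v + r" "c v + r \<le> 1" "r \<noteq> 0" for v r
    using less[OF upd[OF that(1-3)]] that assms(2) pb by (auto simp: inner_add_right)
  have "generic_for T a"
    unfolding generic_for_def
  proof
    fix v assume v: "v \<in> T"
    show "a \<bullet> v \<noteq> 0"
      \<comment> \<open>At least one of the moves to coefficient 1 and to coefficient 0 is a real
        change.\<close>
      using step[OF v, of "1 - c v"] step[OF v, of "- c v"] c(2)[OF v] by (cases "c v = 0") auto
  qed
  moreover have "c v = (if v \<in> pos_gens T a then 1 else 0)" if v: "v \<in> T" for v
  proof (cases "a \<bullet> v > 0")
    case True
    then show ?thesis using step[OF v, of "1 - c v"] c(2)[OF v] v
      by (auto simp: pos_gens_def mult_less_0_iff)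
  next
    case False
    then show ?thesis using step[OF v, of "- c v"] c(2)[OF v] v
      by (auto simp: pos_gens_def zero_less_mult_iff)
  qed
  then have "p = \<Sum>(pos_gens T a)"
    unfolding sum_subset_eq_indicator[OF assms(1) pos_gens_subset] c(1) by simp
  ultimately show thesis using that by blast
qed

section \<open>The graph of a zonotope\<close>

text \<open>The scalar may be negative, so a nonzero generator and its negative cannot both
  occur.\<close>

definition pairwise_noncollinear :: "(real^'n) set \<Rightarrow> bool" where
  "pairwise_noncollinear T \<longleftrightarrow> (\<forall>v\<in>T. \<forall>w\<in>T. \<forall>r. v = r *\<^sub>R w \<longrightarrow> v = w)"

text \<open>Only \<open>u\<close> is orthogonal to \<open>h\<close>, so on the face maximising
  \<open>h\<close> the coefficient of \<open>u\<close> alone is free, and the face is a segment in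
  direction \<open>u\<close>.\<close>

lemma zonotope_edge:
  assumes "finite T" "u \<in> T" "u \<noteq> 0" "h \<bullet> u = 0" "generic_for (T - {u}) h"
  defines "Q \<equiv> pos_gens T h"
  shows "poly_adj (zonotope T) (\<Sum>Q) (\<Sum>(insert u Q))"
proof -
  have uQ: "u \<notin> Q" using assms(4) by (simp add: Q_def pos_gens_def)
  have Qsub: "Q \<subseteq> T" unfolding Q_def by (rule pos_gens_subset)
  have finQ: "finite Q" using Qsub assms(1) finite_subset by blast
  let ?q = "\<Sum>Q"
  have ins: "\<Sum>(insert u Q) = ?q + u" using uQ finQ by simp
  have "zonotope T \<inter> {x. h \<bullet> x = h \<bullet> ?q} = closed_segment ?q (?q + u)"
  proof (intro equalityI subsetI)
    fix x assume "x \<in> zonotope T \<inter> {x. h \<bullet> x = h \<bullet> ?q}"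
    then have x: "x \<in> zonotope T" "h \<bullet> x = h \<bullet> ?q" by auto
    from x(1) obtain c where c: "x = (\<Sum>v\<in>T. c v *\<^sub>R v)" "\<And>v. v \<in> T \<Longrightarrow> 0 \<le> c v \<and> c v \<le> 1"
      by (rule zonotopeE) blast
    have "\<forall>v\<in>T. (h \<bullet> v > 0 \<longrightarrow> c v = 1) \<and> (h \<bullet> v < 0 \<longrightarrow> c v = 0)"
      using zonotope_support(2)[OF assms(1) c(2), of "\<lambda>v. v" h] x(2) c(1) Q_def by simp
    then have "c v = (if v \<in> Q then 1 else 0)" if "v \<in> T - {u}" for v
      using that assms(5) by (auto simp: Q_def pos_gens_def generic_for_def not_less_iff_gr_or_eq)
    then have "(\<Sum>v\<in>T - {u}. c v *\<^sub>R v) = (\<Sum>v\<in>T - {u}. (if v \<in> Q then 1 else 0::real) *\<^sub>R v)"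
      by simp
    also have "\<dots> = ?q"
      using assms(1) Qsub uQ by (intro sum_subset_eq_indicator[symmetric]) auto
    finally have "x = ?q + c u *\<^sub>R u"
      unfolding c(1) using assms(1,2) by (simp add: sum.remove[of T u])
    then have "x = (1 - c u) *\<^sub>R ?q + c u *\<^sub>R (?q + u)"
      by (simp add: algebra_simps)
    then show "x \<in> closed_segment ?q (?q + u)"
      using c(2)[OF assms(2)] unfolding closed_segment_def by blast
  next
    fix x assume x: "x \<in> closed_segment ?q (?q + u)"
    have "?q \<in> zonotope T" "?q + u \<in> zonotope T"
      using sum_subset_in_zonotope[OF assms(1), of "insert u Q"]
        sum_subset_in_zonotope[OF assms(1), of Q] Qsub assms(2) ins by auto
    then have "x \<in> zonotope T"
      using x closed_segment_subset convex_zonotope by blast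
    moreover obtain s where "x = (1 - s) *\<^sub>R ?q + s *\<^sub>R (?q + u)"
      using x unfolding closed_segment_def by blast
    then have "h \<bullet> x = h \<bullet> ?q"
      using assms(4) by (simp add: inner_add_right algebra_simps)
    ultimately show "x \<in> zonotope T \<inter> {x. h \<bullet> x = h \<bullet> ?q}" by simp
  qed
  then have face: "closed_segment ?q (?q + u) face_of zonotope T"
    using zonotope_supporting_face[OF assms(1), of h] unfolding Q_def by simp
  have "?q extreme_point_of closed_segment ?q (?q + u)" "(?q + u) extreme_point_of closed_segment ?q (?q + u)"
    by (simp_all add: extreme_point_of_segment)
  then have "?q \<in> poly_vertices (zonotope T)" "?q + u \<in> poly_vertices (zonotope T)"
    unfolding poly_vertices_def using extreme_point_of_face[OF face] by blast+
  then show ?thesis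
    unfolding poly_adj_def ins using face assms(3) by simp
qed

lemma sym_diff_step_card:
  assumes "finite A" "finite B" "u \<in> sym_diff A B"
    "(u \<in> A \<and> A' = A - {u}) \<or> (u \<notin> A \<and> A' = insert u A)"
  shows "Suc (card (sym_diff A' B)) = card (sym_diff A B)"
proof -
  have "sym_diff A' B = sym_diff A B - {u}" using assms by auto
  moreover have "finite (sym_diff A B)" using assms(1,2) by blast
  ultimately show ?thesis using card_Suc_Diff1 assms(3) by metis
qed

text \<open>The step towards \<open>b\<close>: after a small perturbation of \<open>b\<close> the quotients
  \<open>(b \<bullet> v) / (a \<bullet> v)\<close> are pairwise distinct, and the functional
  \<open>b - \<rho> *\<^sub>R a\<close>, with \<open>\<rho>\<close> the least quotient, exposes an edge.\<close>

lemma vertex_step_towards: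
  assumes "finite T" "0 \<notin> T" "pairwise_noncollinear T"
    and a: "generic_for T a" and b: "generic_for T b" and ne: "pos_gens T a \<noteq> pos_gens T b"
  obtains a' where "generic_for T a'"
    "poly_adj (zonotope T) (\<Sum>(pos_gens T a)) (\<Sum>(pos_gens T a'))"
    "Suc (card (sym_diff (pos_gens T a') (pos_gens T b))) = card (sym_diff (pos_gens T a) (pos_gens T b))"
proof -
  \<comment> \<open>\<open>S\<close> consists of the functionals with the signs of \<open>b\<close>
    on \<open>T\<close>. A functional orthogonal to a member of \<open>W\<close> is one for which
    two quotients coincide. A point \<open>y\<close> of \<open>S\<close> orthogonal to no member of
    \<open>W\<close> is the perturbed \<open>b\<close>.\<close>
  define S where "S = (\<Inter>v\<in>T. {y. 0 < ((b \<bullet> v) *\<^sub>R v) \<bullet> y})"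
  define W where "W = (\<lambda>(v, w). (a \<bullet> w) *\<^sub>R v - (a \<bullet> v) *\<^sub>R w) ` {(v, w). v \<in> T \<and> w \<in> T \<and> v \<noteq> w}"
  have "open S"
    unfolding S_def using assms(1) by (intro open_INT open_halfspace_gt ballI)
  moreover have "b \<in> S"
  proof -
    have "0 < ((b \<bullet> v) *\<^sub>R v) \<bullet> b" if "v \<in> T" for v
    proof -
      have "((b \<bullet> v) *\<^sub>R v) \<bullet> b = (b \<bullet> v)\<^sup>2"
        by (simp only: inner_scaleR_left inner_commute[of v b] power2_eq_square)
      then show ?thesis using b that by (simp add: generic_for_def)
    qed
    then show ?thesis by (simp add: S_def)
  qed
  moreover have "finite W"
  proof -
    have "{(v, w). v \<in> T \<and> w \<in> T \<and> v \<noteq> w} \<subseteq> T \<times> T" by blast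
    then show ?thesis
      unfolding W_def using assms(1) by (meson finite_SigmaI finite_imageI finite_subset)
  qed
  moreover have "0 \<notin> W"
  proof
    assume "0 \<in> W"
    then obtain v w where vw: "v \<in> T" "w \<in> T" "v \<noteq> w" "(a \<bullet> w) *\<^sub>R v = (a \<bullet> v) *\<^sub>R w"
      unfolding W_def by auto
    have "a \<bullet> w \<noteq> 0" using a vw(2) by (auto simp: generic_for_def)
    then have "v = ((a \<bullet> v) / (a \<bullet> w)) *\<^sub>R w"
      using vw(4) by (simp add: eq_vector_fraction_iff)
    then show False using assms(3) vw unfolding pairwise_noncollinear_def by blast
  qed
  ultimately obtain y where y: "y \<in> S" "\<And>w. w \<in> W \<Longrightarrow> y \<bullet> w \<noteq> 0"
    using generic_vector_in_open[of S W thesis] by auto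
  have ysgn: "(b \<bullet> v) * (y \<bullet> v) > 0" if "v \<in> T" for v
    using y(1) that by (simp add: S_def inner_commute[of y v])
  define \<rho> where "\<rho> v = (y \<bullet> v) / (a \<bullet> v)" for v
  have an: "a \<bullet> v \<noteq> 0" if "v \<in> T" for v using a that by (auto simp: generic_for_def)
  have inj: "\<rho> v \<noteq> \<rho> w" if "v \<in> T" "w \<in> T" "v \<noteq> w" for v w
  proof
    assume "\<rho> v = \<rho> w"
    then have "y \<bullet> ((a \<bullet> w) *\<^sub>R v - (a \<bullet> v) *\<^sub>R w) = 0"
      using an that by (simp add: \<rho>_def inner_diff_right field_simps)
    then show False using y(2) that unfolding W_def by blast
  qed
  \<comment> \<open>A negative quotient means that \<open>a\<close> and \<open>b\<close> disagree on
    the sign at \<open>v\<close>.\<close>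
  have neg: "\<rho> v < 0 \<longleftrightarrow> v \<in> sym_diff (pos_gens T a) (pos_gens T b)" if "v \<in> T" for v
    using ysgn[OF that] an[OF that] that
    by (auto simp: \<rho>_def pos_gens_def divide_less_0_iff zero_less_mult_iff)
  obtain u0 where u0: "u0 \<in> sym_diff (pos_gens T a) (pos_gens T b)" using ne by blast
  then have u0T: "u0 \<in> T" using pos_gens_subset by blast
  define u where "u = arg_min_on \<rho> T"
  have uT: "u \<in> T" and umin: "\<And>v. v \<in> T \<Longrightarrow> \<rho> u \<le> \<rho> v"
    using assms(1) u0T arg_min_if_finite(1)[of T \<rho>] arg_min_least[of T _ \<rho>] unfolding u_def by blast+
  \<comment> \<open>The quotient at \<open>u0\<close> is negative, hence so is the least
    one.\<close>
  have uD: "u \<in> sym_diff (pos_gens T a) (pos_gens T b)"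
    using neg[OF uT] neg[OF u0T] u0 umin[OF u0T] by auto
  define h where "h = y - \<rho> u *\<^sub>R a"
  have hv: "h \<bullet> v = (\<rho> v - \<rho> u) * (a \<bullet> v)" if "v \<in> T" for v
    using an[OF that] by (simp add: h_def \<rho>_def inner_diff_left algebra_simps)
  have lt: "\<rho> u < \<rho> v" if "v \<in> T - {u}" for v
    using umin[of v] inj[of u v] uT that by fastforce
  have hu: "h \<bullet> u = 0" using hv[OF uT] by simp
  have hgen: "generic_for (T - {u}) h"
    unfolding generic_for_def using hv lt an by fastforce
  define Q where "Q = pos_gens T h"
  \<comment> \<open>For \<open>v \<noteq> u\<close> the factor \<open>\<rho> v - \<rho> u\<close> is
    positive, so \<open>h\<close> and \<open>a\<close> have the same sign at
    \<open>v\<close>.\<close>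
  have Q: "Q = pos_gens T a - {u}"
  proof -
    have "v \<in> Q \<longleftrightarrow> v \<in> pos_gens T a - {u}" for v
      using hu hv[of v] lt[of v] by (cases "v = u") (auto simp: Q_def pos_gens_def zero_less_mult_iff)
    then show ?thesis by blast
  qed
  have "u \<noteq> 0" using uT assms(2) by blast
  have adj: "poly_adj (zonotope T) (\<Sum>Q) (\<Sum>(insert u Q))"
    unfolding Q_def by (rule zonotope_edge[OF assms(1) uT \<open>u \<noteq> 0\<close> hu hgen])
  then have adj': "poly_adj (zonotope T) (\<Sum>(insert u Q)) (\<Sum>Q)"
    by (auto simp: poly_adj_def closed_segment_commute)
  \<comment> \<open>The edge joins \<open>Q\<close> and \<open>insert u Q\<close>; one of these is
    the subset of \<open>a\<close>, and \<open>A'\<close> is the other.\<close>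
  define A' where "A' = (if u \<in> pos_gens T a then Q else insert u Q)"
  have 1: "poly_adj (zonotope T) (\<Sum>(pos_gens T a)) (\<Sum>A')"
  proof (cases "u \<in> pos_gens T a")
    case True
    then have "pos_gens T a = insert u Q" unfolding Q by blast
    then show ?thesis using adj' True by (simp add: A'_def)
  next
    case False
    then have "pos_gens T a = Q" unfolding Q by blast
    then show ?thesis using adj False by (simp add: A'_def)
  qed
  have A'T: "A' \<subseteq> T" using uT Q pos_gens_subset[of T a] by (auto simp: A'_def)
  have "\<Sum>A' \<in> poly_vertices (zonotope T)" using 1 by (simp add: poly_adj_def)
  then obtain a' where a': "generic_for T a'" "\<Sum>A' = \<Sum>(pos_gens T a')"
    using vertex_generic[OF assms(1,2)] by metis
  then have A'eq: "A' = pos_gens T a'"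
    using generic_unique_subset[OF assms(1) a'(1) A'T] by simp
  have "Suc (card (sym_diff A' (pos_gens T b))) = card (sym_diff (pos_gens T a) (pos_gens T b))"
  proof (rule sym_diff_step_card[OF _ _ uD])
    show "finite (pos_gens T a)" "finite (pos_gens T b)"
      using assms(1) finite_subset[OF pos_gens_subset] by blast+
    show "u \<in> pos_gens T a \<and> A' = pos_gens T a - {u} \<or> u \<notin> pos_gens T a \<and> A' = insert u (pos_gens T a)"
      unfolding A'_def Q by (cases "u \<in> pos_gens T a") simp_all
  qed
  then show thesis using that a'(1) 1 A'eq by simp
qed

text \<open>A generator in the symmetric difference can be added to and subtracted from the
  midpoint of the edge, hence is parallel to it.\<close>

lemma adjacent_vertices_sym_diff:
  assumes "finite T" "0 \<notin> T" "pairwise_noncollinear T"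
    and AB: "A \<subseteq> T" "B \<subseteq> T" and adj: "poly_adj (zonotope T) (\<Sum>A) (\<Sum>B)"
  shows "card (sym_diff A B) \<le> 1"
proof -
  let ?p = "\<Sum>A" and ?q = "\<Sum>B"
  have face: "closed_segment ?p ?q face_of zonotope T" using adj by (simp add: poly_adj_def)
  define m where "m = (1/2) *\<^sub>R (?p + ?q)"
  have par: "\<exists>r. v = r *\<^sub>R (?q - ?p)" if v: "v \<in> sym_diff A B" for v
  proof -
    have vT: "v \<in> T" using v AB by auto
    \<comment> \<open>The average of the two indicators equals 1/2 exactly on the symmetric
      difference, leaving room for 1/2 in both directions.\<close>
    define c where "c w = ((if w \<in> A then 1 else 0) + (if w \<in> B then 1 else 0)) / (2::real)" for w
    have cv: "c v = 1/2" using v by (auto simp: c_def)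
    have mc: "m = (\<Sum>w\<in>T. c w *\<^sub>R w)"
      unfolding m_def sum_subset_eq_indicator[OF assms(1) AB(1)] sum_subset_eq_indicator[OF assms(1) AB(2)]
        sum.distrib[symmetric] scaleR_sum_right
      by (intro sum.cong) (auto simp: c_def simp flip: scaleR_add_left)
    have upd: "m + r *\<^sub>R v \<in> zonotope T" if "- 1/2 \<le> r" "r \<le> 1/2" for r
    proof -
      have "m + r *\<^sub>R v = (\<Sum>w\<in>T. (c(v := 1/2 + r)) w *\<^sub>R w)"
        using assms(1) vT cv unfolding mc by (simp add: sum.remove[of T v] scaleR_add_left)
      also have "\<dots> \<in> zonotope T" using that by (intro zonotopeI) (auto simp: c_def)
      finally show ?thesis .
    qed
    \<comment> \<open>A face that meets the interior of a segment inside the zonotope contains both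
      of its ends.\<close>
    have "m \<in> open_segment (m + (1/2) *\<^sub>R v) (m + (-1/2) *\<^sub>R v)"
    proof -
      have "v \<noteq> 0" using vT assms(2) by blast
      moreover have "(m + (1/2) *\<^sub>R v) - (m + (-1/2) *\<^sub>R v) = v"
        by (simp flip: scaleR_add_left)
      ultimately have "m + (1/2) *\<^sub>R v \<noteq> m + (-1/2) *\<^sub>R v" by auto
      moreover have "m = (1 - 1/2) *\<^sub>R (m + (1/2) *\<^sub>R v) + (1/2) *\<^sub>R (m + (-1/2) *\<^sub>R v)"
        by (simp add: vec_eq_iff field_simps)
      ultimately show ?thesis
        unfolding in_segment by (intro conjI exI[of _ "1/2"]) simp_all
    qed
    moreover have mseg: "m \<in> closed_segment ?p ?q"
      unfolding m_def closed_segment_def by (auto simp: algebra_simps intro!: exI[of _ "1/2"])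
    ultimately have "m + (1/2) *\<^sub>R v \<in> closed_segment ?p ?q"
      using face_ofD[OF face _ upd[of "1/2"] upd[of "-1/2"], of m] by simp
    then obtain s where s: "m + (1/2) *\<^sub>R v = (1 - s) *\<^sub>R ?p + s *\<^sub>R ?q"
      unfolding closed_segment_def by blast
    have "v = (2 * s - 1) *\<^sub>R (?q - ?p)"
    proof (rule vec_eq_iff[THEN iffD2, rule_format])
      fix i
      show "v $ i = ((2 * s - 1) *\<^sub>R (?q - ?p)) $ i"
        using arg_cong[OF s, of "\<lambda>x. x $ i"] unfolding m_def
        by (simp del: sum_component add: algebra_simps)
    qed
    then show ?thesis by blast
  qed
  have "v = w" if vw: "v \<in> sym_diff A B" "w \<in> sym_diff A B" for v w
  proof -
    obtain r s where rs: "v = r *\<^sub>R (?q - ?p)" "w = s *\<^sub>R (?q - ?p)"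
      using par[OF vw(1)] par[OF vw(2)] by blast
    have T: "v \<in> T" "w \<in> T" using vw AB by auto
    then have "s \<noteq> 0" using rs assms(2) by auto
    then have "v = (r / s) *\<^sub>R w" using rs by simp
    then show ?thesis using T assms(3) unfolding pairwise_noncollinear_def by blast
  qed
  moreover have "finite (sym_diff A B)" using assms(1) AB finite_subset by blast
  ultimately show ?thesis by (metis One_nat_def card_le_Suc0_iff_eq)
qed

section \<open>Walks and graph distance\<close>

lemma poly_walk_Cons:
  "poly_walk P (x # xs) \<longleftrightarrow>
     x \<in> poly_vertices P \<and> (xs = [] \<or> (poly_adj P x (hd xs) \<and> poly_walk P xs))"
  by (cases xs) (auto simp: poly_walk_def nth_Cons split: nat.splits)

lemma card_sym_diff_triangle:
  assumes "finite A" "finite B" "finite C"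
  shows "card (sym_diff A C) \<le> card (sym_diff A B) + card (sym_diff B C)"
proof -
  have "card (sym_diff A C) \<le> card (sym_diff A B \<union> sym_diff B C)"
    using assms by (intro card_mono) auto
  also have "\<dots> \<le> card (sym_diff A B) + card (sym_diff B C)" by (rule card_Un_le)
  finally show ?thesis .
qed

text \<open>Each edge changes the subset by at most one generator, and the triangle inequality adds
  this up. The bound is strict because \<open>length xs\<close> counts vertices, one more than the
  edges.\<close>

lemma zonotope_walk_length_ge:
  assumes T: "finite T" "0 \<notin> T" "pairwise_noncollinear T"
    and "generic_for T a" "generic_for T b" "poly_walk (zonotope T) xs"
    "hd xs = \<Sum>(pos_gens T a)" "last xs = \<Sum>(pos_gens T b)"
  shows "card (sym_diff (pos_gens T a) (pos_gens T b)) < length xs"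
  using assms(4-8)
proof (induction xs arbitrary: a)
  case Nil
  then show ?case by (simp add: poly_walk_def)
next
  case (Cons x xs)
  show ?case
  proof (cases "xs = []")
    case True
    then have "\<Sum>(pos_gens T a) = \<Sum>(pos_gens T b)" using Cons.prems by simp
    then have "pos_gens T a = pos_gens T b"
      using generic_unique_subset[OF T(1) Cons.prems(2) pos_gens_subset] by blast
    then show ?thesis by simp
  next
    case False
    then have walk: "poly_adj (zonotope T) x (hd xs)" "poly_walk (zonotope T) xs"
      using Cons.prems(3) by (auto simp: poly_walk_Cons)
    then have "hd xs \<in> poly_vertices (zonotope T)" by (simp add: poly_adj_def)
    then obtain c where c: "generic_for T c" "hd xs = \<Sum>(pos_gens T c)"
      using vertex_generic[OF T(1,2)] by blast
    have fin: "finite (pos_gens T z)" for z using T(1) pos_gens_subset finite_subset by blast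
    have "card (sym_diff (pos_gens T a) (pos_gens T c)) \<le> 1"
      using walk(1) c(2) Cons.prems(4)
      by (intro adjacent_vertices_sym_diff[OF T pos_gens_subset pos_gens_subset]) simp
    moreover have "card (sym_diff (pos_gens T c) (pos_gens T b)) < length xs"
      using Cons.prems False c walk(2) by (intro Cons.IH) auto
    ultimately show ?thesis
      using card_sym_diff_triangle[OF fin fin fin, of a b c] by simp
  qed
qed

text \<open>Iterating \<open>vertex_step_towards\<close> removes one element of the symmetric
  difference per edge.\<close>

lemma zonotope_walk_exists:
  assumes T: "finite T" "0 \<notin> T" "pairwise_noncollinear T"
    and "generic_for T a" "generic_for T b"
    and "card (sym_diff (pos_gens T a) (pos_gens T b)) = n"
  shows "\<exists>xs. poly_walk (zonotope T) xs \<and> hd xs = \<Sum>(pos_gens T a) \<and> last xs = \<Sum>(pos_gens T b)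
    \<and> length xs = Suc n"
  using assms(4-6)
proof (induction n arbitrary: a)
  case 0
  have "finite (pos_gens T z)" for z using T(1) pos_gens_subset finite_subset by blast
  then have "pos_gens T a = pos_gens T b" using 0 by auto
  then have "poly_walk (zonotope T) [\<Sum>(pos_gens T a)]"
    using generic_vertex[OF T(1) 0(1)] by (simp add: poly_walk_Cons)
  then show ?case using \<open>pos_gens T a = pos_gens T b\<close> by (intro exI[of _ "[\<Sum>(pos_gens T a)]"]) simp
next
  case (Suc n)
  then have "pos_gens T a \<noteq> pos_gens T b" by auto
  then obtain a' where a': "generic_for T a'"
    "poly_adj (zonotope T) (\<Sum>(pos_gens T a)) (\<Sum>(pos_gens T a'))"
    "Suc (card (sym_diff (pos_gens T a') (pos_gens T b))) = card (sym_diff (pos_gens T a) (pos_gens T b))"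
    by (rule vertex_step_towards[OF T Suc.prems(1,2)])
  then obtain xs where xs: "poly_walk (zonotope T) xs" "hd xs = \<Sum>(pos_gens T a')"
    "last xs = \<Sum>(pos_gens T b)" "length xs = Suc n"
    using Suc.IH[of a'] Suc.prems by auto
  have "poly_walk (zonotope T) (\<Sum>(pos_gens T a) # xs)"
    using xs a'(2) by (auto simp: poly_walk_Cons poly_adj_def)
  then show ?case using xs by (intro exI[of _ "\<Sum>(pos_gens T a) # xs"]) auto
qed

lemma zonotope_graph_dist:
  assumes "finite T" "0 \<notin> T" "pairwise_noncollinear T" "generic_for T a" "generic_for T b"
  shows "graph_dist (zonotope T) (\<Sum>(pos_gens T a)) (\<Sum>(pos_gens T b)) =
    card (sym_diff (pos_gens T a) (pos_gens T b))"
  unfolding graph_dist_def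
proof (rule Least_equality)
  fix n assume "\<exists>xs. poly_walk (zonotope T) xs \<and> hd xs = \<Sum>(pos_gens T a) \<and>
    last xs = \<Sum>(pos_gens T b) \<and> length xs = Suc n"
  then obtain xs where "poly_walk (zonotope T) xs" "hd xs = \<Sum>(pos_gens T a)"
    "last xs = \<Sum>(pos_gens T b)" "length xs = Suc n" by blast
  then show "card (sym_diff (pos_gens T a) (pos_gens T b)) \<le> n"
    using zonotope_walk_length_ge[OF assms, of xs] by simp
qed (rule zonotope_walk_exists[OF assms refl])

text \<open>Symmetric differences are subsets of \<open>T\<close>, and passing from \<open>a\<close>
  to \<open>- a\<close> complements the subset. Since the value is attained, the \<open>Sup\<close>
  is a maximum.\<close>

lemma zonotope_edge_diameter:
  assumes "finite T" "0 \<notin> T" "pairwise_noncollinear T"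
  shows "edge_diameter (zonotope T) = card T"
  unfolding edge_diameter_def
proof (rule cSup_eq_maximum)
  obtain a where "generic_for T a"
    unfolding generic_for_def
    using generic_vector_in_open[OF open_UNIV UNIV_not_empty assms(1,2)] by metis
  then have a: "generic_for T a" "generic_for T (- a)" by (auto simp: generic_for_def)
  have "sym_diff (pos_gens T a) (pos_gens T (- a)) = T"
    using a(1) by (auto simp: pos_gens_def generic_for_def)
  then have "graph_dist (zonotope T) (\<Sum>(pos_gens T a)) (\<Sum>(pos_gens T (- a))) = card T"
    using zonotope_graph_dist[OF assms a] by simp
  then show "card T \<in> {graph_dist (zonotope T) v w | v w.
      v \<in> poly_vertices (zonotope T) \<and> w \<in> poly_vertices (zonotope T)}"
    using generic_vertex[OF assms(1) a(1)] generic_vertex[OF assms(1) a(2)]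
    by (intro CollectI exI[of _ "\<Sum>(pos_gens T a)"] exI[of _ "\<Sum>(pos_gens T (- a))"]) simp
next
  fix n assume "n \<in> {graph_dist (zonotope T) v w | v w.
      v \<in> poly_vertices (zonotope T) \<and> w \<in> poly_vertices (zonotope T)}"
  then obtain v w where n: "n = graph_dist (zonotope T) v w"
    and vw: "v \<in> poly_vertices (zonotope T)" "w \<in> poly_vertices (zonotope T)" by blast
  obtain a where a: "generic_for T a" "v = \<Sum>(pos_gens T a)"
    using vertex_generic[OF assms(1,2) vw(1)] .
  obtain b where b: "generic_for T b" "w = \<Sum>(pos_gens T b)"
    using vertex_generic[OF assms(1,2) vw(2)] .
  show "n \<le> card T"
    unfolding n a(2) b(2) zonotope_graph_dist[OF assms a(1) b(1)]
    using assms(1) pos_gens_subset by (intro card_mono) blast+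
qed

section \<open>Translation invariance of the graph and its diameter\<close>

lemma poly_vertices_translation:
  "poly_vertices ((\<lambda>x. x + t) ` P) = (\<lambda>x. x + t) ` poly_vertices P"
proof -
  have "(x + t) extreme_point_of (\<lambda>x. x + t) ` P \<longleftrightarrow> x extreme_point_of P" for x
    using extreme_point_of_translation_eq[of t x P] by (simp add: add.commute)
  then show ?thesis
    unfolding poly_vertices_def by (auto simp: image_iff) (metis diff_add_cancel)
qed

lemma poly_adj_translation:
  "poly_adj ((\<lambda>x. x + t) ` P) (v + t) (w + t) \<longleftrightarrow> poly_adj P v w"
proof -
  have "closed_segment (v + t) (w + t) = (+) t ` closed_segment v w"
    by (simp add: closed_segment_translation add.commute)
  moreover have "(\<lambda>x. x + t) ` P = (+) t ` P" by (simp add: add.commute)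
  ultimately show ?thesis
    unfolding poly_adj_def poly_vertices_translation
    by (auto simp: face_of_translation_eq image_iff)
qed

lemma poly_walk_translation:
  "poly_walk ((\<lambda>x. x + t) ` P) (map (\<lambda>x. x + t) xs) \<longleftrightarrow> poly_walk P xs"
proof (induction xs)
  case Nil
  then show ?case by (simp add: poly_walk_def)
next
  case (Cons x xs)
  then show ?case
    using poly_adj_translation[of t P x "hd xs"]
    by (cases xs) (auto simp: poly_walk_Cons poly_vertices_translation)
qed

lemma graph_dist_translation:
  "graph_dist ((\<lambda>x. x + t) ` P) (v + t) (w + t) = graph_dist P v w"
proof -
  have "(\<exists>xs. poly_walk ((\<lambda>x. x + t) ` P) xs \<and> hd xs = v + t \<and> last xs = w + t \<and> length xs = Suc n)
    \<longleftrightarrow> (\<exists>xs. poly_walk P xs \<and> hd xs = v \<and> last xs = w \<and> length xs = Suc n)" (is "?L \<longleftrightarrow> ?R") for n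
  proof
    assume ?L
    then obtain xs where xs: "poly_walk ((\<lambda>x. x + t) ` P) xs" "hd xs = v + t" "last xs = w + t"
      "length xs = Suc n" by blast
    define ys where "ys = map (\<lambda>x. x - t) xs"
    have "xs = map (\<lambda>x. x + t) ys" by (simp add: ys_def o_def)
    then have "poly_walk P ys" using xs(1) poly_walk_translation by metis
    moreover have "xs \<noteq> []" using xs(4) by auto
    then have "hd ys = v" "last ys = w" "length ys = Suc n"
      using xs by (simp_all add: ys_def hd_map last_map)
    ultimately show ?R by blast
  next
    assume ?R
    then obtain xs where xs: "poly_walk P xs" "hd xs = v" "last xs = w" "length xs = Suc n" by blast
    moreover have "xs \<noteq> []" using xs(4) by auto
    ultimately show ?L
      by (intro exI[of _ "map (\<lambda>x. x + t) xs"]) (simp add: poly_walk_translation hd_map last_map)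
  qed
  then show ?thesis by (simp add: graph_dist_def)
qed

lemma edge_diameter_translation: "edge_diameter ((\<lambda>x. x + t) ` P) = edge_diameter P"
proof -
  have "{graph_dist ((\<lambda>x. x + t) ` P) v w | v w.
      v \<in> poly_vertices ((\<lambda>x. x + t) ` P) \<and> w \<in> poly_vertices ((\<lambda>x. x + t) ` P)}
    = {graph_dist P v w | v w. v \<in> poly_vertices P \<and> w \<in> poly_vertices P}"
    unfolding poly_vertices_translation
  proof (intro equalityI subsetI)
    fix n assume "n \<in> {graph_dist P v w | v w. v \<in> poly_vertices P \<and> w \<in> poly_vertices P}"
    then obtain v w where "n = graph_dist ((\<lambda>x. x + t) ` P) (v + t) (w + t)"
      "v \<in> poly_vertices P" "w \<in> poly_vertices P"
      by (auto simp: graph_dist_translation)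
    then show "n \<in> {graph_dist ((\<lambda>x. x + t) ` P) v w | v w.
        v \<in> (\<lambda>x. x + t) ` poly_vertices P \<and> w \<in> (\<lambda>x. x + t) ` poly_vertices P}"
      by blast
  qed (clarsimp simp: graph_dist_translation, blast)
  then show ?thesis by (simp add: edge_diameter_def)
qed

section \<open>Lattice zonotopes from pairs of indices\<close>

text \<open>For finite \<open>T\<close> this is the negative of the coordinatewise minimum of the
  zonotope, so adding it makes every coordinate range start at 0.\<close>

definition shift_vec :: "(real^'n) set \<Rightarrow> real^'n" where
  "shift_vec T = (\<chi> i. \<Sum>v\<in>T. max 0 (- v $ i))"

text \<open>After the shift, coordinate \<open>i\<close> of a subset sum is an integer between 0 and
  the sum of all \<open>\<bar>v $ i\<bar>\<close>. The origin and the unit vectors lie in the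
  zonotope, which gives full dimension.\<close>

lemma lattice_polytope_shifted_zonotope:
  fixes T :: "(real^'n) set"
  assumes fin: "finite T" and int: "\<And>v i. v \<in> T \<Longrightarrow> v $ i \<in> \<int>"
    and width: "\<And>i. (\<Sum>v\<in>T. \<bar>v $ i\<bar>) \<le> real k" and axes: "\<And>i. axis i 1 \<in> T"
  shows "lattice_polytope k ((\<lambda>x. x + shift_vec T) ` zonotope T)"
  unfolding lattice_polytope_def
proof
  let ?S = "(\<lambda>x. x + shift_vec T) ` Sum ` Pow T"
  have "(\<Sum>B + shift_vec T) $ i \<in> real ` {0..k}" if B: "B \<subseteq> T" for B i
  proof -
    \<comment> \<open>Each summand lies between 0 and \<open>\<bar>v $ i\<bar>\<close>, whether or
      not \<open>v\<close> belongs to \<open>B\<close>.\<close>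
    define f where "f v = (if v \<in> B then v $ i else 0) + max 0 (- v $ i)" for v
    have "\<Sum>B $ i = (\<Sum>v\<in>T. if v \<in> B then v $ i else 0)"
      unfolding sum_component using B fin by (simp add: sum.inter_restrict[symmetric] Int_absorb1)
    then have eq: "(\<Sum>B + shift_vec T) $ i = (\<Sum>v\<in>T. f v)"
      by (simp add: shift_vec_def f_def sum.distrib)
    have "(\<Sum>v\<in>T. f v) \<in> \<int>"
      unfolding f_def by (intro Ints_sum Ints_add) (auto simp: int max_def)
    then obtain z where z: "(\<Sum>v\<in>T. f v) = of_int z" by (rule Ints_cases)
    have "(\<Sum>v\<in>T. f v) \<ge> 0" by (rule sum_nonneg) (auto simp: f_def)
    moreover have "(\<Sum>v\<in>T. f v) \<le> (\<Sum>v\<in>T. \<bar>v $ i\<bar>)" by (rule sum_mono) (auto simp: f_def)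
    ultimately have "0 \<le> z" "z \<le> int k" using z width[of i] by linarith+
    then have "(\<Sum>v\<in>T. f v) = real (nat z)" "nat z \<in> {0..k}" using z by auto
    then show ?thesis unfolding eq by blast
  qed
  then have "?S \<subseteq> {x. \<forall>i. x $ i \<in> real ` {0..k}}" by blast
  moreover have "(\<lambda>x. x + shift_vec T) ` zonotope T = convex hull ?S"
    using convex_hull_translation[of "shift_vec T" "Sum ` Pow T"]
    by (simp add: zonotope_eq_convex_hull[OF fin] add.commute)
  ultimately show "\<exists>S. finite S \<and> S \<subseteq> {x. \<forall>i. x $ i \<in> real ` {0..k}} \<and>
      (\<lambda>x. x + shift_vec T) ` zonotope T = convex hull S"
    using fin by (intro exI[of _ ?S]) auto
next
  have sub: "\<Sum>B \<in> affine hull zonotope T" if "B \<subseteq> T" for B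
    using sum_subset_in_zonotope[OF fin that] by (rule hull_inc)
  have "0 \<in> affine hull zonotope T" using sub[of "{}"] by simp
  then have "affine hull zonotope T = span (zonotope T)" by (rule affine_hull_span_0)
  moreover have "(Basis :: (real^'n) set) \<subseteq> zonotope T"
  proof
    fix b :: "real^'n" assume "b \<in> Basis"
    then obtain i where "b = axis i 1" by (auto simp: Basis_vec_def)
    then show "b \<in> zonotope T" using sum_subset_in_zonotope[OF fin, of "{b}"] axes by auto
  qed
  then have "span (zonotope T) = UNIV" using span_mono span_Basis by blast
  ultimately have "aff_dim (zonotope T) = int CARD('n)" 
    using aff_dim_eq_full[of "zonotope T"] by simp
  then show "aff_dim ((\<lambda>x. x + shift_vec T) ` zonotope T) = int CARD('n)"
    using aff_dim_translation_eq[of "shift_vec T" "zonotope T"] by (simp add: add.commute)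
qed

text \<open>Ordered pairs of indices parametrise the generators bijectively: \<open>(i, i)\<close> stands for
  \<open>e\<^sub>i\<close>, and for \<open>i < j\<close> the pairs \<open>(i, j)\<close> and \<open>(j, i)\<close> stand for \<open>e\<^sub>i + e\<^sub>j\<close> and \<open>e\<^sub>i - e\<^sub>j\<close>.\<close>

definition pair_ivec :: "'n \<times> 'n \<Rightarrow> int^('n::{finite,linorder})" where
  "pair_ivec p = (\<chi> l. if l = min (fst p) (snd p) then 1
     else if l = max (fst p) (snd p) then (if fst p < snd p then 1 else - 1) else 0)"

definition pair_vec :: "'n \<times> 'n \<Rightarrow> real^('n::{finite,linorder})" where
  "pair_vec p = vec_of_int (pair_ivec p)"

lemma pair_vec_component:
  "pair_vec p $ l = (if l = min (fst p) (snd p) then 1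
     else if l = max (fst p) (snd p) then (if fst p < snd p then 1 else - 1) else 0)"
  by (simp add: pair_vec_def vec_of_int_def pair_ivec_def)

text \<open>This turns coordinate widths into vertex degrees in which a loop counts once.\<close>

lemma abs_pair_vec: "\<bar>pair_vec p $ l\<bar> = (if fst p = l \<or> snd p = l then 1 else 0)"
  by (auto simp: pair_vec_component min_def max_def)

lemma pair_vec_diag: "pair_vec (i, i) = axis i 1"
  by (auto simp: vec_eq_iff pair_vec_component axis_def)

text \<open>Equal supports give equal minimum and maximum of the pairs. The entry at the minimum is
  1 in both vectors, so \<open>r = 1\<close>, and the sign at the maximum recovers the order within
  the pair.\<close>

lemma pair_vec_noncollinear:
  assumes "pair_vec p = r *\<^sub>R pair_vec q"
  shows "p = q"
proof -
  let ?m = "\<lambda>p::'a \<times> 'a. min (fst p) (snd p)" and ?M = "\<lambda>p::'a \<times> 'a. max (fst p) (snd p)"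
  have eq: "pair_vec p $ l = r * pair_vec q $ l" for l using assms by simp
  have supp: "pair_vec p $ l \<noteq> 0 \<longleftrightarrow> l = ?m p \<or> l = ?M p" for p :: "'a \<times> 'a" and l
    by (auto simp: pair_vec_component)
  have "r \<noteq> 0" using eq[of "?m p"] by (auto simp: pair_vec_component)
  then have supp_eq: "l = ?m p \<or> l = ?M p \<longleftrightarrow> l = ?m q \<or> l = ?M q" for l
    using supp[of p l] supp[of q l] eq[of l] by simp
  have le: "?m p \<le> ?M p" "?m q \<le> ?M q" by (auto simp: min_def max_def)
  have m: "?m p = ?m q" and M: "?M p = ?M q"
    using le supp_eq by (metis order.antisym)+
  have "r = 1" using eq[of "?m p"] m by (simp add: pair_vec_component)
  then have "?m p = ?M p \<or> (fst p < snd p \<longleftrightarrow> fst q < snd q)"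
    using eq[of "?M p"] m M by (auto simp: pair_vec_component split: if_splits)
  then show ?thesis
    using m M by (cases p; cases q) (auto simp: min_def max_def split: if_splits)
qed

lemma inj_pair_vec: "inj pair_vec"
  using pair_vec_noncollinear[of _ 1] by (metis injI scaleR_one)

text \<open>Reduces the geometry to counting: the degrees of \<open>R\<close> bound the coordinate
  widths and its size is the diameter.\<close>

lemma pair_zonotope:
  fixes R :: "('n::{finite,linorder} \<times> 'n) set"
  assumes diag: "\<And>i. (i, i) \<in> R" and deg: "\<And>i. card {p \<in> R. fst p = i \<or> snd p = i} \<le> k"
  defines "T \<equiv> pair_vec ` R"
  shows "lattice_polytope k ((\<lambda>x. x + shift_vec T) ` zonotope T)"
    and "edge_diameter ((\<lambda>x. x + t) ` zonotope T) = card R"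
proof -
  have inj: "inj_on pair_vec R" using inj_pair_vec inj_on_subset by blast
  show "lattice_polytope k ((\<lambda>x. x + shift_vec T) ` zonotope T)"
  proof (rule lattice_polytope_shifted_zonotope)
    show "axis i 1 \<in> T" for i unfolding T_def using diag pair_vec_diag by (metis imageI)
    fix i
    have "(\<Sum>v\<in>T. \<bar>v $ i\<bar>) = (\<Sum>p\<in>R. if fst p = i \<or> snd p = i then 1 else 0)"
      unfolding T_def by (simp add: sum.reindex[OF inj] abs_pair_vec)
    also have "\<dots> = real (card {p \<in> R. fst p = i \<or> snd p = i})"
      by (simp add: sum.If_cases Int_def)
    finally show "(\<Sum>v\<in>T. \<bar>v $ i\<bar>) \<le> real k" using deg[of i] by simp
  qed (auto simp: T_def pair_vec_component)
  have "edge_diameter (zonotope T) = card T"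
  proof (rule zonotope_edge_diameter)
    show "0 \<notin> T"
    proof
      assume "0 \<in> T"
      then obtain p :: "'n \<times> 'n" where "pair_vec p = 0" unfolding T_def by (metis imageE)
      then have "pair_vec p $ min (fst p) (snd p) = 0" by simp
      then show False by (simp add: pair_vec_component)
    qed
    show "pairwise_noncollinear T"
      unfolding pairwise_noncollinear_def T_def by (metis imageE pair_vec_noncollinear)
  qed (simp add: T_def)
  also have "card T = card R" unfolding T_def using inj by (rule card_image)
  finally show "edge_diameter ((\<lambda>x. x + t) ` zonotope T) = card R"
    by (simp add: edge_diameter_translation)
qed

section \<open>The generator sets as images of index pairs\<close>

lemma pair_ivec_props:
  "l1norm_int (pair_ivec p) \<le> 2" "vgcd (pair_ivec p) = 1" "lex_pos (pair_ivec p)"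
proof -
  have "l1norm_int (pair_ivec p) = (\<Sum>l\<in>UNIV. if l \<in> {fst p, snd p} then 1 else 0)"
    unfolding l1norm_int_def by (intro sum.cong) (auto simp: pair_ivec_def min_def max_def)
  also have "\<dots> = int (card {fst p, snd p})" by (simp del: insert_iff add: sum.If_cases)
  also have "\<dots> \<le> 2" by (simp add: card_insert_if)
  finally show "l1norm_int (pair_ivec p) \<le> 2" .
  have m: "pair_ivec p $ min (fst p) (snd p) = 1" by (simp add: pair_ivec_def)
  then show "vgcd (pair_ivec p) = 1"
    unfolding vgcd_def by (metis Gcd_1 Gcd_eq_1_I is_unit_triv one_dvd rangeI)
  have "pair_ivec p $ j = 0" if "j < min (fst p) (snd p)" for j
    using that by (auto simp: pair_ivec_def)
  then show "lex_pos (pair_ivec p)" unfolding lex_pos_def using m by (metis zero_less_one)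
qed

text \<open>The norm bound allows at most two nonzero entries. If there are two, both are 1 or -1
  and the first is 1 by lexicographic positivity; if there is one, the gcd condition makes it
  1.\<close>

lemma lex_pos_small_is_pair_ivec:
  fixes v :: "int^('n::{finite,linorder})"
  assumes l1: "l1norm_int v \<le> 2" and gcd: "vgcd v = 1" and lex: "lex_pos v"
  shows "\<exists>p. v = pair_ivec p"
proof -
  obtain i where i: "v $ i > 0" "\<And>j. j < i \<Longrightarrow> v $ j = 0" using lex unfolding lex_pos_def by blast
  have sub: "(\<Sum>l\<in>S. \<bar>v $ l\<bar>) \<le> 2" for S
  proof -
    have "(\<Sum>l\<in>S. \<bar>v $ l\<bar>) \<le> l1norm_int v"
      unfolding l1norm_int_def by (rule sum_mono2) auto
    then show ?thesis using l1 by simp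
  qed
  show ?thesis
  proof (cases "\<exists>j. j \<noteq> i \<and> v $ j \<noteq> 0")
    case True
    then obtain j where j: "j \<noteq> i" "v $ j \<noteq> 0" by blast
    then have ij: "i < j" using i(2)[of j] by (meson linorder_neqE)
    have "\<bar>v $ i\<bar> + \<bar>v $ j\<bar> \<le> 2" using sub[of "{i, j}"] j by simp
    then have vi: "v $ i = 1" and vj: "v $ j = 1 \<or> v $ j = - 1" using i(1) j(2) by linarith+
    have other: "v $ l = 0" if "l \<noteq> i" "l \<noteq> j" for l
    proof -
      have "\<bar>v $ i\<bar> + (\<bar>v $ j\<bar> + \<bar>v $ l\<bar>) \<le> 2" using sub[of "{i, j, l}"] j(1) that by simp
      then show ?thesis using vi vj by auto
    qed
    show ?thesis
    proof (cases "v $ j = 1")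
      case True
      then have "v = pair_ivec (i, j)"
        using vi other ij by (auto simp: vec_eq_iff pair_ivec_def min_def max_def)
      then show ?thesis ..
    next
      case False
      then have "v = pair_ivec (j, i)"
        using vi vj other ij by (auto simp: vec_eq_iff pair_ivec_def min_def max_def)
      then show ?thesis ..
    qed
  next
    case False
    have "v $ i dvd vgcd v"
      unfolding vgcd_def using False by (intro Gcd_greatest) (auto, metis dvd_0_right dvd_refl)
    then have "v $ i = 1" using gcd i(1) by simp
    then have "v = pair_ivec (i, i)" using False by (auto simp: vec_eq_iff pair_ivec_def)
    then show ?thesis ..
  qed
qed

lemma G1_eq: "(G1 :: (real^'n::{finite,linorder}) set) = range pair_vec"
proof -
  have "{v :: (int, 'n) vec. l1norm_int v \<le> 2 \<and> vgcd v = 1 \<and> lex_pos v} = range pair_ivec"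
  proof (intro equalityI subsetI)
    fix v :: "(int, 'n) vec"
    assume "v \<in> {v. l1norm_int v \<le> 2 \<and> vgcd v = 1 \<and> lex_pos v}"
    then show "v \<in> range pair_ivec" using lex_pos_small_is_pair_ivec by blast
  qed (auto simp: pair_ivec_props)
  then show ?thesis unfolding G1_def pair_vec_def by (simp add: image_image)
qed

text \<open>A nonnegative vector with gcd 1 is nonzero, hence lexicographically positive and some
  \<open>pair_ivec p\<close>; having no entry -1 means \<open>fst p \<le> snd p\<close>.\<close>

lemma G1plus_eq: "(G1plus :: (real^'n::{finite,linorder}) set) = pair_vec ` {p. fst p \<le> snd p}"
proof -
  have nonneg: "(\<forall>l. pair_ivec p $ l \<ge> 0) \<longleftrightarrow> fst p \<le> snd p" for p :: "'n \<times> 'n"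
  proof
    assume "\<forall>l. pair_ivec p $ l \<ge> 0"
    then have "pair_ivec p $ max (fst p) (snd p) \<ge> 0" by blast
    then show "fst p \<le> snd p" by (auto simp: pair_ivec_def min_def max_def split: if_splits)
  qed (auto simp: pair_ivec_def)
  have "lex_pos v" if "\<forall>i. v $ i \<ge> 0" "vgcd v = 1" for v :: "(int, 'n) vec"
  proof -
    have ne: "{i. v $ i \<noteq> 0} \<noteq> {}"
    proof
      assume "{i. v $ i \<noteq> 0} = {}"
      then have "range (\<lambda>i. v $ i) = {0}" by auto
      then show False using that(2) by (simp add: vgcd_def)
    qed
    define i where "i = Min {i. v $ i \<noteq> 0}"
    have "i \<in> {i. v $ i \<noteq> 0}" unfolding i_def by (rule Min_in[OF finite ne])
    then have "v $ i > 0" using that(1) by (simp add: order_less_le)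
    moreover have "v $ j = 0" if "j < i" for j
    proof (rule ccontr)
      assume "v $ j \<noteq> 0"
      then have "i \<le> j" unfolding i_def by (intro Min_le[OF finite] CollectI)
      then show False using that by simp
    qed
    ultimately show ?thesis unfolding lex_pos_def by blast
  qed
  note lex = this
  have "{v :: (int, 'n) vec. (\<forall>i. v $ i \<ge> 0) \<and> l1norm_int v \<le> 2 \<and> vgcd v = 1}
    = pair_ivec ` {p. fst p \<le> snd p}"
  proof (intro equalityI subsetI)
    fix v :: "(int, 'n) vec"
    assume v: "v \<in> {v. (\<forall>i. v $ i \<ge> 0) \<and> l1norm_int v \<le> 2 \<and> vgcd v = 1}"
    then obtain p where p: "v = pair_ivec p" using lex lex_pos_small_is_pair_ivec by blast
    then have "fst p \<le> snd p" using v nonneg[of p] by simp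
    then show "v \<in> pair_ivec ` {p. fst p \<le> snd p}" using p by blast
  qed (auto simp: pair_ivec_props nonneg[THEN iffD2])
  then show ?thesis unfolding G1plus_def pair_vec_def by (simp add: image_image)
qed

section \<open>Choosing the generators\<close>

text \<open>The pairs \<open>(i, i + s)\<close> modulo \<open>d\<close> with \<open>s \<le> m\<close> give every index degree \<open>2 * m + 1\<close>,
  the loop at \<open>i\<close> counting once. For even \<open>k\<close> the difference \<open>d - 1\<close> is still
  unused and carries the matching \<open>(1, 0), (3, 2), \<dots>\<close>.\<close>

lemma index_pairs_exist:
  fixes d k :: nat
  assumes "1 \<le> k" "k \<le> 2 * d - 1"
  obtains R where "R \<subseteq> {..<d} \<times> {..<d}" "\<And>i. i < d \<Longrightarrow> (i, i) \<in> R"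
    "\<And>i. i < d \<Longrightarrow> card {p \<in> R. fst p = i \<or> snd p = i} \<le> k"
    "card R = (k + 1) * d div 2"
proof -
  \<comment> \<open>The largest \<open>m\<close> with \<open>2 * m + 1 \<le> k\<close>; one unit of
    degree is left over exactly when \<open>k\<close> is even.\<close>
  define m where "m = (k - 1) div 2"
  have d: "d > 0" and md: "m < d" using assms by (auto simp: m_def)
  \<comment> \<open>The pairs \<open>(i, j)\<close> and \<open>(j, i)\<close> are distinct
    generators, so all differences below \<open>d\<close> may be used, beyond \<open>d / 2\<close>
    as well.\<close>
  define C where "C = (\<lambda>(i, s). (i, (i + s) mod d)) ` ({..<d} \<times> {..m})"
  define M where "M = (if even k then (\<lambda>j. (2 * j + 1, 2 * j)) ` {..<d div 2} else {})"
  have mod_inj_le: "s = s'" if "(i + s) mod d = (i + s') mod d" "s \<le> s'" "s' < d" for i s s' :: nat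
  proof -
    have "d dvd s' - s" using that mod_eq_dvd_iff_nat[of "i + s" "i + s'" d] by simp
    then have "s' - s = 0" using that(3) by (metis dvd_imp_le less_imp_diff_less linorder_not_less neq0_conv)
    then show ?thesis using that(2) by simp
  qed
  have mod_inj: "s = s'" if "(i + s) mod d = (i + s') mod d" "s < d" "s' < d" for i s s' :: nat
    using mod_inj_le[of i s s'] mod_inj_le[of i s' s] that by (cases "s \<le> s'") auto
  have Csub: "C \<subseteq> {..<d} \<times> {..<d}" using d by (auto simp: C_def)
  have Msub: "M \<subseteq> {..<d} \<times> {..<d}" by (auto simp: M_def)
  have diag: "(i, i) \<in> C" if "i < d" for i
    unfolding C_def using that by (intro image_eqI[of _ _ "(i, 0)"]) auto
  have "inj_on (\<lambda>(i, s). (i, (i + s) mod d)) ({..<d} \<times> {..m})"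
  proof (rule inj_onI, clarsimp)
    fix i s s' assume "s \<le> m" "s' \<le> m" "(i + s) mod d = (i + s') mod d"
    then show "s = s'" using mod_inj[of i s s'] md by simp
  qed
  then have cardC: "card C = d * Suc m"
    unfolding C_def by (subst card_image) (auto simp: card_cartesian_product)
  have cardM: "card M = (if even k then d div 2 else 0)"
    by (auto simp: M_def card_image inj_on_def)
  have disj: "C \<inter> M = {}"
  proof (cases "even k")
    case True
    \<comment> \<open>An even \<open>k\<close> is at most \<open>2 * d - 2\<close>, which keeps the
      matching difference \<open>d - 1\<close> above \<open>m\<close>.\<close>
    then have m2: "m + 2 \<le> d" using assms unfolding m_def by presburger
    have False if pC: "p \<in> C" and pM: "p \<in> M" for p
    proof -
      obtain j where j: "p = (2 * j + 1, 2 * j)" "j < d div 2"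
        using pM True by (auto simp: M_def)
      obtain s where s: "s \<le> m" "(2 * j + 1 + s) mod d = 2 * j"
        using pC j(1) by (auto simp: C_def)
      have "(2 * j + 1 + s) mod d = (2 * j + 1 + (d - 1)) mod d"
      proof -
        have "2 * j + 1 + (d - 1) = 2 * j + d" using d by simp
        moreover have "2 * j < d" using j(2) by linarith
        ultimately show ?thesis using s(2) by (simp only: mod_add_self2 mod_less)
      qed
      then have "s = d - 1" using s(1) md d mod_inj[of "2 * j + 1" s "d - 1"] by simp
      then show False using s(1) m2 by simp
    qed
    then show ?thesis by blast
  qed (simp add: M_def)
  have degC: "card {p \<in> C. fst p = i \<or> snd p = i} \<le> 2 * m + 1" if i: "i < d" for i
  proof -
    \<comment> \<open>The pairs starting at \<open>i\<close> and those ending at \<open>i\<close>.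
      The loop is already among the former, so the second range begins at 1;
      \<open>i + (d - s)\<close> is \<open>i - s\<close> modulo \<open>d\<close> without truncated
      subtraction.\<close>
    have "{p \<in> C. fst p = i \<or> snd p = i} \<subseteq>
        (\<lambda>s. (i, (i + s) mod d)) ` {..m} \<union> (\<lambda>s. ((i + (d - s)) mod d, i)) ` {1..m}"
    proof
      fix p assume "p \<in> {p \<in> C. fst p = i \<or> snd p = i}"
      then obtain a s where p: "p = (a, (a + s) mod d)" "a < d" "s \<le> m" "a = i \<or> (a + s) mod d = i"
        by (auto simp: C_def)
      show "p \<in> (\<lambda>s. (i, (i + s) mod d)) ` {..m} \<union> (\<lambda>s. ((i + (d - s)) mod d, i)) ` {1..m}"
      proof (cases "a = i")
        case True
        then show ?thesis using p by auto
      next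
        case False
        then have ai: "(a + s) mod d = i" using p by blast
        have "s \<noteq> 0"
        proof
          assume "s = 0"
          then show False using ai False p(2) by simp
        qed
        have "(i + (d - s)) mod d = (a + s + (d - s)) mod d"
          unfolding ai[symmetric] by (rule mod_add_left_eq)
        also have "\<dots> = a" using p(2,3) md by simp
        finally show ?thesis using p \<open>s \<noteq> 0\<close> ai by (intro UnI2 image_eqI[of _ _ s]) auto
      qed
    qed
    then have "card {p \<in> C. fst p = i \<or> snd p = i} \<le>
        card ((\<lambda>s. (i, (i + s) mod d)) ` {..m} \<union> (\<lambda>s. ((i + (d - s)) mod d, i)) ` {1..m})"
      by (intro card_mono) auto
    also have "\<dots> \<le> card ((\<lambda>s. (i, (i + s) mod d)) ` {..m}) + card ((\<lambda>s. ((i + (d - s)) mod d, i)) ` {1..m})"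
      by (rule card_Un_le)
    also have "\<dots> \<le> card {..m} + card {1..m}" by (intro add_mono card_image_le) auto
    finally show ?thesis by simp
  qed
  have degM: "card {p \<in> M. fst p = i \<or> snd p = i} \<le> (if even k then 1 else 0)" for i
  proof (cases "even k")
    case True
    \<comment> \<open>Matching pairs are blocks of two consecutive indices, so \<open>i\<close> can
      only lie in the block of \<open>i div 2\<close>.\<close>
    have "{p \<in> M. fst p = i \<or> snd p = i} \<subseteq> {(2 * (i div 2) + 1, 2 * (i div 2))}"
      using True by (auto simp: M_def)
    then have "card {p \<in> M. fst p = i \<or> snd p = i} \<le> card {(2 * (i div 2) + 1, 2 * (i div 2))}"
      by (intro card_mono) auto
    then show ?thesis using True by simp
  qed (simp add: M_def)
  have k: "2 * m + 1 + (if even k then 1 else 0) = k"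
    using assms(1) unfolding m_def by presburger
  show thesis
  proof (rule that[of "C \<union> M"])
    show "C \<union> M \<subseteq> {..<d} \<times> {..<d}" using Csub Msub by blast
    show "(i, i) \<in> C \<union> M" if "i < d" for i using diag[OF that] by blast
    show "card {p \<in> C \<union> M. fst p = i \<or> snd p = i} \<le> k" if "i < d" for i
    proof -
      have "{p \<in> C \<union> M. fst p = i \<or> snd p = i} =
          {p \<in> C. fst p = i \<or> snd p = i} \<union> {p \<in> M. fst p = i \<or> snd p = i}" by blast
      then have "card {p \<in> C \<union> M. fst p = i \<or> snd p = i} \<le> card {p \<in> C. fst p = i \<or> snd p = i} + card {p \<in> M. fst p = i \<or> snd p = i}"
        using card_Un_le[of "{p \<in> C. fst p = i \<or> snd p = i}" "{p \<in> M. fst p = i \<or> snd p = i}"] by simp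
      also have "\<dots> \<le> k"
        using add_mono[OF degC[OF that] degM[of i]] k by (simp only:)
      finally show ?thesis .
    qed
    have "card (C \<union> M) = d * Suc m + (if even k then d div 2 else 0)"
      using card_Un_disjoint[OF _ _ disj] finite_subset[OF Csub] finite_subset[OF Msub] cardC cardM
      by simp
    also have "\<dots> = (k + 1) * d div 2"
    proof (cases "even k")
      case True
      then have k_even: "k = 2 * m + 2" using k by simp
      have "(k + 1) * d = 2 * (d * Suc m) + d" using k_even by (simp add: algebra_simps)
      then show ?thesis using True by simp
    next
      case False
      then have k_odd: "k = 2 * m + 1" using k by simp
      have "(k + 1) * d = 2 * (d * Suc m)" using k_odd by (simp add: algebra_simps)
      then show ?thesis using False by simp
    qed
    finally show "card (C \<union> M) = (k + 1) * d div 2" .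
  qed
qed

text \<open>The pairs are pulled back along an enumeration of the index type, which preserves loops,
  degree bounds and the number of pairs.\<close>

lemma type_index_pairs_exist:
  assumes "1 \<le> k" "k \<le> 2 * CARD('n::finite) - 1"
  obtains R :: "('n::finite \<times> 'n) set" where "\<And>i. (i, i) \<in> R"
    "\<And>i. card {p \<in> R. fst p = i \<or> snd p = i} \<le> k"
    "card R = (k + 1) * CARD('n) div 2"
proof -
  let ?d = "CARD('n)"
  obtain Q where Q: "Q \<subseteq> {..<?d} \<times> {..<?d}" "\<And>i. i < ?d \<Longrightarrow> (i, i) \<in> Q"
    "\<And>i. i < ?d \<Longrightarrow> card {p \<in> Q. fst p = i \<or> snd p = i} \<le> k" "card Q = (k + 1) * ?d div 2"
    using index_pairs_exist[OF assms] by blast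
  obtain f :: "'n \<Rightarrow> nat" where f: "bij_betw f UNIV {0..<?d}"
    using ex_bij_betw_finite_nat[of "UNIV :: 'n set"] by auto
  have inj: "inj (map_prod f f)" using f by (simp add: bij_betw_def prod.inj_map)
  have flt: "f i < ?d" for i using f by (auto simp: bij_betw_def)
  have "range (map_prod f f) = {..<?d} \<times> {..<?d}"
    using f by (simp add: bij_betw_def map_prod_surj_on[of f UNIV _ f UNIV, simplified] lessThan_atLeast0)
  then have QR: "Q \<subseteq> range (map_prod f f)" using Q(1) by simp
  define R where "R = map_prod f f -` Q"
  have "card R = card Q"
    unfolding R_def using inj QR by (rule card_vimage_inj)
  moreover have "card {p \<in> R. fst p = i \<or> snd p = i} \<le> k" for i
  proof -
    have "map_prod f f ` {p \<in> R. fst p = i \<or> snd p = i} \<subseteq> {p \<in> Q. fst p = f i \<or> snd p = f i}"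
      by (auto simp: R_def)
    moreover have "finite {p \<in> Q. fst p = f i \<or> snd p = f i}"
      using Q(1) by (simp add: finite_subset)
    ultimately have "card (map_prod f f ` {p \<in> R. fst p = i \<or> snd p = i}) \<le> k"
      using card_mono Q(3)[OF flt, of i] order_trans by blast
    then show ?thesis by (simp only: card_image[OF inj_on_subset[OF inj subset_UNIV]])
  qed
  moreover have "(i, i) \<in> R" for i using Q(2)[OF flt] by (simp add: R_def)
  ultimately show thesis using Q(4) by (intro that[of R]) simp_all
qed

section \<open>Finitely many lattice polytopes, and lower bounds for \<open>delta\<close>\<close>

text \<open>Each one is the hull of a subset of a finite grid.\<close>

lemma finite_lattice_polytopes: "finite {P :: (real^'n) set. lattice_polytope k P}"
proof -
  let ?G = "{x :: real^'n. \<forall>i. x $ i \<in> real ` {0..k}}"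
  have "?G \<subseteq> vec_lambda ` (UNIV \<rightarrow>\<^sub>E real ` {0..k})"
  proof
    fix x assume x: "x \<in> ?G"
    show "x \<in> vec_lambda ` (UNIV \<rightarrow>\<^sub>E real ` {0..k})"
      using x by (intro image_eqI[of _ _ "vec_nth x"]) auto
  qed
  then have "finite ?G"
    by (rule finite_subset) (intro finite_imageI finite_PiE, auto)
  moreover have "{P. lattice_polytope k P} \<subseteq> (\<lambda>S. convex hull S) ` Pow ?G"
    unfolding lattice_polytope_def by blast
  ultimately show ?thesis by (meson finite_Pow_iff finite_imageI finite_subset)
qed

text \<open>Finiteness bounds the set of diameters, which ensures that its \<open>Sup\<close>
  dominates every member.\<close>

lemma delta_ge_edge_diameter:
  fixes P :: "(real^'n) set"
  assumes "lattice_polytope k P"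
  shows "edge_diameter P \<le> delta TYPE('n) k"
  unfolding delta_def
proof (rule cSup_upper)
  have "{edge_diameter P | P :: (real^'n) set. lattice_polytope k P} =
      edge_diameter ` {P :: (real^'n) set. lattice_polytope k P}" by blast
  then show "bdd_above {edge_diameter P | P :: (real^'n) set. lattice_polytope k P}"
    using finite_lattice_polytopes by (metis bdd_above_finite finite_imageI)
qed (use assms in blast)

text \<open>Swapping matches increasing with decreasing pairs, and together with the diagonal they
  exhaust the square.\<close>

lemma card_le_pairs: "card {p :: 'n::{finite,linorder} \<times> 'n. fst p \<le> snd p} = (CARD('n) + 1) choose 2"
proof -
  let ?L = "{p :: 'n \<times> 'n. fst p < snd p}" and ?D = "{p :: 'n \<times> 'n. fst p = snd p}"
  have D: "card ?D = CARD('n)"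
  proof -
    have "?D = range (\<lambda>i. (i, i))" by auto
    then show ?thesis by (simp add: card_image inj_on_def)
  qed
  have "card ?L = card {p :: 'n \<times> 'n. snd p < fst p}"
    by (rule bij_betw_same_card[of prod.swap]) (auto simp: bij_betw_def inj_on_def image_iff)
  moreover have "(UNIV :: ('n \<times> 'n) set) = ?L \<union> ({p. snd p < fst p} \<union> ?D)" by auto
  then have "CARD('n \<times> 'n) = card (?L \<union> ({p. snd p < fst p} \<union> ?D))" by simp
  then have "CARD('n) * CARD('n) = card ?L + (card {p :: 'n \<times> 'n. snd p < fst p} + card ?D)"
    by (subst (asm) card_Un_disjoint, simp, simp, force, subst (asm) card_Un_disjoint) auto
  moreover have "{p :: 'n \<times> 'n. fst p \<le> snd p} = ?L \<union> ?D" by auto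
  then have "card {p :: 'n \<times> 'n. fst p \<le> snd p} = card ?L + card ?D"
    by (simp only:) (rule card_Un_disjoint, auto)
  ultimately have "2 * card {p :: 'n \<times> 'n. fst p \<le> snd p} = (CARD('n) + 1) * CARD('n)"
    using D by simp
  then show ?thesis by (simp add: choose_two)
qed

section \<open>The selected generators, \<open>H1plus\<close> and \<open>H1\<close>\<close>

theorem theorem3p2:
  fixes k :: nat
  assumes "1 \<le> k" and "k \<le> 2 * CARD('n::{finite,linorder}) - 1"
  shows "(\<exists>T \<subseteq> (G1 :: (real^'n::{finite,linorder}) set). \<exists>t.
            lattice_polytope k ((\<lambda>x. x + t) ` zonotope T) \<and>
            edge_diameter ((\<lambda>x. x + t) ` zonotope T) = ((k + 1) * CARD('n::{finite,linorder})) div 2)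
       \<and> delta TYPE('n::{finite,linorder}) k \<ge> ((k + 1) * CARD('n::{finite,linorder})) div 2
       \<and> lattice_polytope CARD('n::{finite,linorder}) (H1plus :: (real^'n::{finite,linorder}) set)
       \<and> edge_diameter (H1plus :: (real^'n::{finite,linorder}) set) = (CARD('n::{finite,linorder}) + 1) choose 2
       \<and> (\<exists>t. lattice_polytope (2 * CARD('n::{finite,linorder}) - 1) ((\<lambda>x. x + t) ` (H1 :: (real^'n::{finite,linorder}) set))
              \<and> edge_diameter ((\<lambda>x. x + t) ` (H1 :: (real^'n::{finite,linorder}) set)) = CARD('n::{finite,linorder}) ^ 2)"
proof -
  obtain R :: "('n \<times> 'n) set" where R: "\<And>i. (i, i) \<in> R"
    "\<And>i. card {p \<in> R. fst p = i \<or> snd p = i} \<le> k" "card R = (k + 1) * CARD('n) div 2"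
    by (rule type_index_pairs_exist[OF assms]) blast
  have sub: "pair_vec ` R \<subseteq> G1" by (auto simp: G1_eq)
  have part1: "lattice_polytope k ((\<lambda>x. x + shift_vec (pair_vec ` R)) ` zonotope (pair_vec ` R))"
    "edge_diameter ((\<lambda>x. x + shift_vec (pair_vec ` R)) ` zonotope (pair_vec ` R)) = (k + 1) * CARD('n) div 2"
    using pair_zonotope[OF R(1,2)] R(3) by auto

  let ?U = "{p :: 'n \<times> 'n. fst p \<le> snd p}"
  have degU: "card {p \<in> ?U. fst p = i \<or> snd p = i} \<le> CARD('n)" for i
  proof -
    \<comment> \<open>A pair with \<open>fst p \<le> snd p\<close> that contains \<open>i\<close> is
      determined by its other entry \<open>j\<close>.\<close>
    have "{p \<in> ?U. fst p = i \<or> snd p = i} \<subseteq> range (\<lambda>j. (min i j, max i j))"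
    proof
      fix p assume "p \<in> {p \<in> ?U. fst p = i \<or> snd p = i}"
      then have "p = (min i (snd p), max i (snd p)) \<or> p = (min i (fst p), max i (fst p))"
        by (cases p) (auto simp: min_def max_def)
      then show "p \<in> range (\<lambda>j. (min i j, max i j))" by blast
    qed
    then have "card {p \<in> ?U. fst p = i \<or> snd p = i} \<le> card (range (\<lambda>j. (min i j, max i j)))"
      by (rule card_mono[OF finite])
    also have "\<dots> \<le> CARD('n)" by (rule card_image_le[OF finite])
    finally show ?thesis .
  qed
  \<comment> \<open>All entries of these generators are nonnegative, so \<open>H1plus\<close> is a
    lattice polytope as it stands.\<close>
  have "shift_vec (pair_vec ` ?U) = 0"
    unfolding shift_vec_def vec_eq_iff by (auto intro!: sum.neutral simp: pair_vec_component)
  then have part2: "lattice_polytope CARD('n) (H1plus :: (real, 'n) vec set)"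
    "edge_diameter (H1plus :: (real, 'n) vec set) = (CARD('n) + 1) choose 2"
    using pair_zonotope[OF _ degU] pair_zonotope(2)[OF _ degU, of 0]
    by (simp_all add: H1plus_def G1plus_eq card_le_pairs)

  have degUNIV: "card {p \<in> (UNIV :: ('n \<times> 'n) set). fst p = i \<or> snd p = i} \<le> 2 * CARD('n) - 1" for i
  proof -
    \<comment> \<open>Row and column of \<open>i\<close> share the loop \<open>(i, i)\<close>, which
      accounts for the \<open>- 1\<close> in the bound.\<close>
    have "{p \<in> UNIV. fst p = i \<or> snd p = i} \<subseteq> Pair i ` UNIV \<union> (\<lambda>j. (j, i)) ` (UNIV - {i})"
      by (auto simp: image_iff)
    then have "card {p \<in> (UNIV :: ('n \<times> 'n) set). fst p = i \<or> snd p = i}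
        \<le> card (Pair i ` UNIV \<union> (\<lambda>j. (j, i)) ` (UNIV - {i}))"
      by (intro card_mono) auto
    also have "\<dots> \<le> card (Pair i ` (UNIV :: 'n set)) + card ((\<lambda>j. (j, i)) ` (UNIV - {i}))"
      by (rule card_Un_le)
    also have "\<dots> \<le> CARD('n) + card (UNIV - {i})"
      by (intro add_mono card_image_le) auto
    also have "\<dots> = 2 * CARD('n) - 1" by (simp add: card_Diff_singleton)
    finally show ?thesis .
  qed
  let ?s = "shift_vec (G1 :: (real, 'n) vec set)"
  have part3: "lattice_polytope (2 * CARD('n) - 1) ((\<lambda>x. x + ?s) ` H1)"
    "edge_diameter ((\<lambda>x. x + ?s) ` (H1 :: (real, 'n) vec set)) = CARD('n) ^ 2"
    using pair_zonotope[OF _ degUNIV]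
    by (simp_all add: H1_def G1_eq power2_eq_square)
  show ?thesis
    using sub part1 part2 part3 delta_ge_edge_diameter[OF part1(1), unfolded part1(2)] by blast
qed

end
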